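(* Let $G$ be a finite simple graph with minimum degree $\delta(G)\geq 1$, and let $M(G)$ be its Mycielskian. Then $\chi_d^t(G)+1 \leq \chi_d^t(M(G)) \leq \chi_d^t(G)+2$.
   Context: All graphs are finite, undirected and simple. A proper coloring of $G$ partitions $V(G)$ into nonempty color classes. A total dominator coloring (TDC) of $G$ is a proper coloring of $G$ in which every vertex of $G$ is adjacent to every vertex of some color class. The total dominator chromatic number $\chi_d^t(G)$ is the minimum number of color classes in a TDC of $G$. If $V(G)=\{v_1,\dots,v_n\}$, the Mycielskian $M(G)$ is the graph with vertex set $V(G)\cup\{u_1,\dots,u_n\}\cup\{w\}$ and edge set $E(G)\cup\{u_iv_j : v_iv_j\in E(G)\}\cup\{u_iw : 1\le i\le n\}$. *)

theory Defs
  imports "Graph_Theory.Pair_Digraph" "HOL-Library.Disjoint_Sets"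
begin

text \<open>
  A finite simple undirected graph is a \<open>pair_graph\<close>: an undirected edge \<open>uv\<close> is represented by the
  two arcs \<open>(u, v)\<close> and \<open>(v, u)\<close>, so the degree of a vertex is its out-degree.
\<close>

definition min_degree :: "'a pair_pre_digraph \<Rightarrow> nat" where
  "min_degree G = Min (out_degree (with_proj G) ` pverts G)"

text \<open>A colouring is identified with its set of (nonempty) colour classes.\<close>

definition proper_coloring :: "'a pair_pre_digraph \<Rightarrow> 'a set set \<Rightarrow> bool" where
  "proper_coloring G P \<longleftrightarrow>
     partition_on (pverts G) P \<and> (\<forall>C\<in>P. \<forall>u\<in>C. \<forall>v\<in>C. (u, v) \<notin> parcs G)"

definition total_dominator_coloring :: "'a pair_pre_digraph \<Rightarrow> 'a set set \<Rightarrow> bool" where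
  "total_dominator_coloring G P \<longleftrightarrow>
     proper_coloring G P \<and> (\<forall>v\<in>pverts G. \<exists>C\<in>P. \<forall>u\<in>C. (v, u) \<in> parcs G)"

text \<open>
  Only meaningful if a total dominator colouring exists, which is the case for finite simple graphs
  without isolated vertices; see \<open>total_dominator_coloring_singletons\<close> below.
\<close>

definition total_dominator_chromatic_number :: "'a pair_pre_digraph \<Rightarrow> nat" where
  "total_dominator_chromatic_number G =
     (LEAST k. \<exists>P. total_dominator_coloring G P \<and> card P = k)"

text \<open>\<open>Orig v\<^sub>i\<close>, \<open>Copy v\<^sub>i\<close> and \<open>Apex\<close> stand for \<open>v\<^sub>i\<close>, \<open>u\<^sub>i\<close> and \<open>w\<close>.\<close>

datatype 'a mycielskian_vertex = Orig 'a | Copy 'a | Apex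

definition mycielskian :: "'a pair_pre_digraph \<Rightarrow> 'a mycielskian_vertex pair_pre_digraph" where
  "mycielskian G =
     \<lparr> pverts = Orig ` pverts G \<union> Copy ` pverts G \<union> {Apex},
       parcs =
         {(Orig x, Orig y) | x y. (x, y) \<in> parcs G} \<union>
         {(Copy x, Orig y) | x y. (x, y) \<in> parcs G} \<union>
         {(Orig y, Copy x) | x y. (x, y) \<in> parcs G} \<union>
         {(Copy x, Apex) | x. x \<in> pverts G} \<union>
         {(Apex, Copy x) | x. x \<in> pverts G} \<rparr>"

lemma min_degree_ge_1_iff:
  assumes "pair_graph G" and "pverts G \<noteq> {}"
  shows "min_degree G \<ge> 1 \<longleftrightarrow> (\<forall>v\<in>pverts G. \<exists>u. (v, u) \<in> parcs G)"
proof -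
  interpret pair_graph G by fact
  have "out_degree (with_proj G) v \<ge> 1 \<longleftrightarrow> (\<exists>u. (v, u) \<in> parcs G)" for v
  proof -
    have "finite {e \<in> parcs G. fst e = v}" by (simp add: pair_finite_arcs)
    then show ?thesis
      by (auto simp: out_degree_def out_arcs_def Suc_le_eq card_gt_0_iff)
  qed
  then show ?thesis
    using assms(2) pair_finite_verts by (simp add: min_degree_def)
qed

lemma total_dominator_coloring_singletons:
  assumes "pair_graph G" and "\<forall>v\<in>pverts G. \<exists>u. (v, u) \<in> parcs G"
  shows "total_dominator_coloring G ((\<lambda>v. {v}) ` pverts G)"
proof -
  interpret pair_graph G by fact
  have "partition_on (pverts G) ((\<lambda>v. {v}) ` pverts G)"
    by (auto simp: partition_on_def disjoint_def)
  moreover have "(v, v) \<notin> parcs G" for v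
    using pair_no_loops by fastforce
  ultimately show ?thesis
    using assms(2) in_arcsD2
    by (fastforce simp: total_dominator_coloring_def proper_coloring_def)
qed

lemma pair_graph_mycielskian:
  assumes "pair_graph G"
  shows "pair_graph (mycielskian G)"
proof -
  interpret pair_graph G by fact
  have sym: "(y, x) \<in> parcs G" if "(x, y) \<in> parcs G" for x y
    using arcs_symmetric that by auto
  have irrefl: "(x, x) \<notin> parcs G" for x
    using pair_no_loops by fastforce
  have fin: "finite (pverts (mycielskian G))"
    by (simp add: mycielskian_def pair_finite_verts)
  have sub: "parcs (mycielskian G) \<subseteq> pverts (mycielskian G) \<times> pverts (mycielskian G)"
    by (auto simp: mycielskian_def dest: in_arcsD1 in_arcsD2)
  have "sym (parcs (mycielskian G))"
    by (auto simp: mycielskian_def intro!: symI dest: sym)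
  moreover have "fst e \<noteq> snd e" if "e \<in> parcs (mycielskian G)" for e
    using that by (auto simp: mycielskian_def irrefl)
  moreover have "finite (parcs (mycielskian G))"
    using finite_subset[OF sub] fin by simp
  moreover have "fst e \<in> pverts (mycielskian G)" "snd e \<in> pverts (mycielskian G)"
    if "e \<in> parcs (mycielskian G)" for e
    using that sub by auto
  ultimately show ?thesis
    using fin by unfold_locales (auto simp: symmetric_def arcs_ends_conv)
qed

lemma mycielskian_no_isolated:
  assumes "pair_graph G" and "pverts G \<noteq> {}" and "\<forall>v\<in>pverts G. \<exists>u. (v, u) \<in> parcs G"
  shows "\<forall>v\<in>pverts (mycielskian G). \<exists>u. (v, u) \<in> parcs (mycielskian G)"
proof
  fix v assume v: "v \<in> pverts (mycielskian G)"
  obtain x where x: "x \<in> pverts G" using assms(2) by blast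
  show "\<exists>u. (v, u) \<in> parcs (mycielskian G)"
  proof (cases v)
    case (Orig y)
    then have "y \<in> pverts G" using v by (auto simp: mycielskian_def)
    then obtain z where "(y, z) \<in> parcs G" using assms(3) by blast
    then have "(v, Orig z) \<in> parcs (mycielskian G)" using Orig by (simp add: mycielskian_def)
    then show ?thesis ..
  next
    case (Copy y)
    then have "(v, Apex) \<in> parcs (mycielskian G)" using v by (auto simp: mycielskian_def)
    then show ?thesis ..
  next
    case Apex
    then have "(v, Copy x) \<in> parcs (mycielskian G)" using x by (simp add: mycielskian_def)
    then show ?thesis ..
  qed
qed

end

theory Submission
  imports Defs
begin

text \<open>
  For the upper bound, keep a colouring of \<open>G\<close> on the original vertices and give one new colour to
  all copies and one to the apex.

  For the lower bound, let \<open>Q\<close> be a total dominator colouring of the Mycielskian. The apex dominates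
  a class consisting of copies only. If the apex shares its class with other vertices, then
  every copy dominates a class that contains an original vertex, so restricting \<open>Q\<close> to the original
  vertices is a total dominator colouring that misses a class of copies. If the apex is alone in
  its class, pick one representative from every class consisting of copies only, and recolour the
  original vertex of that representative with the colour of this class; the colour of the apex
  is then unused.
\<close>

lemma total_dominator_chromatic_number_le_colors:
  assumes fin: "finite K"
    and range: "\<And>v. v \<in> pverts G \<Longrightarrow> c v \<in> K"
    and proper: "\<And>u v. (u, v) \<in> parcs G \<Longrightarrow> u \<in> pverts G \<Longrightarrow> v \<in> pverts G \<Longrightarrow> c u \<noteq> c v"
    and dominator: "\<And>v. v \<in> pverts G \<Longrightarrow>
      \<exists>w\<in>pverts G. \<forall>u\<in>pverts G. c u = c w \<longrightarrow> (v, u) \<in> parcs G"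
  shows "total_dominator_chromatic_number G \<le> card K"
proof -
  \<comment> \<open>Indexing by the image of \<open>c\<close> rather than by \<open>K\<close> keeps
    empty fibres out of the partition.\<close>
  define P where "P = (\<lambda>i. {u \<in> pverts G. c u = i}) ` c ` pverts G"
  have "partition_on (pverts G) P"
    by (auto simp: P_def partition_on_def disjoint_def)
  moreover have "(u, v) \<notin> parcs G" if "C \<in> P" "u \<in> C" "v \<in> C" for C u v
    using that proper by (fastforce simp: P_def)
  moreover have "\<exists>C\<in>P. \<forall>u\<in>C. (v, u) \<in> parcs G" if "v \<in> pverts G" for v
    using dominator[OF that] by (auto simp: P_def)
  ultimately have "total_dominator_coloring G P"
    by (auto simp: total_dominator_coloring_def proper_coloring_def)
  then have "total_dominator_chromatic_number G \<le> card P"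
    unfolding total_dominator_chromatic_number_def by (auto intro: Least_le)
  also have "card P \<le> card (c ` pverts G)"
    unfolding P_def using fin range by (intro card_image_le) (auto intro: finite_subset)
  also have "\<dots> \<le> card K"
    using fin range by (auto intro: card_mono)
  finally show ?thesis .
qed

lemma total_dominator_chromatic_number_attained:
  assumes "pair_graph G" and "\<forall>v\<in>pverts G. \<exists>u. (v, u) \<in> parcs G"
  obtains P where "total_dominator_coloring G P"
    and "card P = total_dominator_chromatic_number G" and "finite P"
proof -
  interpret pair_graph G by fact
  have "\<exists>P. total_dominator_coloring G P \<and> card P = total_dominator_chromatic_number G"
    unfolding total_dominator_chromatic_number_def
    by (rule LeastI_ex) (use total_dominator_coloring_singletons[OF assms] in blast)
  then obtain P where P: "total_dominator_coloring G P"
    "card P = total_dominator_chromatic_number G" by blast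
  moreover have "finite P"
    using P(1) finite_elements[OF pair_finite_verts]
    unfolding total_dominator_coloring_def proper_coloring_def by blast
  ultimately show ?thesis by (rule that)
qed

lemma pverts_mycielskian [simp]:
  "Orig v \<in> pverts (mycielskian G) \<longleftrightarrow> v \<in> pverts G"
  "Copy v \<in> pverts (mycielskian G) \<longleftrightarrow> v \<in> pverts G"
  "Apex \<in> pverts (mycielskian G)"
  by (auto simp: mycielskian_def)

lemma parcs_mycielskian [simp]:
  "(Orig u, Orig v) \<in> parcs (mycielskian G) \<longleftrightarrow> (u, v) \<in> parcs G"
  "(Copy u, Orig v) \<in> parcs (mycielskian G) \<longleftrightarrow> (u, v) \<in> parcs G"
  "(Orig u, Copy v) \<in> parcs (mycielskian G) \<longleftrightarrow> (v, u) \<in> parcs G"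
  "(Copy u, Copy v) \<notin> parcs (mycielskian G)"
  "(Copy u, Apex) \<in> parcs (mycielskian G) \<longleftrightarrow> u \<in> pverts G"
  "(Apex, Copy u) \<in> parcs (mycielskian G) \<longleftrightarrow> u \<in> pverts G"
  "(Orig u, Apex) \<notin> parcs (mycielskian G)"
  "(Apex, Orig u) \<notin> parcs (mycielskian G)"
  "(Apex, Apex) \<notin> parcs (mycielskian G)"
  by (auto simp: mycielskian_def)

text \<open>Passes from a set of classes back to a colour function: each class serves as the colour
  of its own elements, and disjointness makes this choice unique.\<close>

lemma partition_on_class_map:
  assumes "partition_on A P"
  obtains q where "\<And>x. x \<in> A \<Longrightarrow> q x \<in> P" and "\<And>x C. C \<in> P \<Longrightarrow> x \<in> C \<Longrightarrow> q x = C"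
    and "\<And>x. x \<in> A \<Longrightarrow> x \<in> q x"
proof -
  obtain q where q: "\<forall>x\<in>A. q x \<in> P \<and> x \<in> q x"
    using assms bchoice[of A "\<lambda>x C. C \<in> P \<and> x \<in> C"] by (auto simp: partition_on_def)
  have "q x = C" if "C \<in> P" "x \<in> C" for x C
  proof -
    have "x \<in> A" using assms that by (auto simp: partition_on_def)
    then show ?thesis using assms that q by (auto simp: partition_on_def disjoint_def)
  qed
  with q show ?thesis by (intro that[of q]) auto
qed

lemma total_dominator_chromatic_number_mycielskian_le:
  assumes "pair_graph G" and "pverts G \<noteq> {}" and "\<forall>v\<in>pverts G. \<exists>u. (v, u) \<in> parcs G"
  shows "total_dominator_chromatic_number (mycielskian G)
    \<le> total_dominator_chromatic_number G + 2"
proof -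
  let ?M = "mycielskian G"
  obtain P where P: "total_dominator_coloring G P"
    and card_P: "card P = total_dominator_chromatic_number G" and fin: "finite P"
    using total_dominator_chromatic_number_attained[OF assms(1,3)] .
  have part: "partition_on (pverts G) P"
    and proper: "\<And>C u v. C \<in> P \<Longrightarrow> u \<in> C \<Longrightarrow> v \<in> C \<Longrightarrow> (u, v) \<notin> parcs G"
    and dominator: "\<And>v. v \<in> pverts G \<Longrightarrow> \<exists>C\<in>P. \<forall>u\<in>C. (v, u) \<in> parcs G"
    using P by (auto simp: total_dominator_coloring_def proper_coloring_def)
  obtain q where q: "\<And>v. v \<in> pverts G \<Longrightarrow> q v \<in> P"
      "\<And>v C. C \<in> P \<Longrightarrow> v \<in> C \<Longrightarrow> q v = C" "\<And>v. v \<in> pverts G \<Longrightarrow> v \<in> q v"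
    by (rule partition_on_class_map[OF part]) blast
  have q_proper: "q u \<noteq> q v" if "(u, v) \<in> parcs G" "u \<in> pverts G" "v \<in> pverts G" for u v
    using that q proper by metis
  \<comment> \<open>The vertex datatype, now over sets, serves as the colour type: its constructors
    keep the three groups of colours apart. The argument \<open>{}\<close> is a dummy.\<close>
  define c where "c = case_mycielskian_vertex (\<lambda>v. Orig (q v)) (\<lambda>_. Copy {}) Apex"
  have c: "c (Orig v) = Orig (q v)" "c (Copy v) = Copy {}" "c Apex = Apex" for v
    by (auto simp: c_def)
  have dom: "\<exists>w\<in>pverts G. \<forall>u\<in>pverts G. q u = q w \<longrightarrow> (v, u) \<in> parcs G"
    if v: "v \<in> pverts G" for v
  proof -
    obtain C where C: "C \<in> P" "\<forall>u\<in>C. (v, u) \<in> parcs G" using dominator[OF v] by blast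
    moreover have "C \<noteq> {}" "C \<subseteq> pverts G"
      using C(1) part by (auto simp: partition_on_def)
    ultimately obtain w where "w \<in> C" "w \<in> pverts G" by blast
    then show ?thesis using C q by metis
  qed
  have "total_dominator_chromatic_number ?M \<le> card (Orig ` P \<union> {Copy {}, Apex})"
  proof (rule total_dominator_chromatic_number_le_colors[where c = c])
    show "finite (Orig ` P \<union> {Copy {}, Apex})" using fin by simp
    show "c x \<in> Orig ` P \<union> {Copy {}, Apex}" if "x \<in> pverts ?M" for x
      using that q(1) by (cases x) (auto simp: c)
    show "c x \<noteq> c y"
      if "(x, y) \<in> parcs ?M" "x \<in> pverts ?M" "y \<in> pverts ?M" for x y
      using that q_proper by (cases x; cases y) (auto simp: c)
    show "\<exists>z\<in>pverts ?M. \<forall>y\<in>pverts ?M. c y = c z \<longrightarrow> (x, y) \<in> parcs ?M"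
      if "x \<in> pverts ?M" for x
    proof -
      \<comment> \<open>\<open>Orig v\<close> and \<open>Copy v\<close> have the same neighbours
        among the originals, and the colour of \<open>Orig w\<close> occurs on originals only, so a
        class dominated by \<open>v\<close> in \<open>G\<close> serves both.\<close>
      have lift: ?thesis if v: "v \<in> pverts G" and x: "x = Orig v \<or> x = Copy v" for v
      proof -
        obtain w where w: "w \<in> pverts G" "\<forall>u\<in>pverts G. q u = q w \<longrightarrow> (v, u) \<in> parcs G"
          using dom[OF v] by blast
        have "(x, y) \<in> parcs ?M" if "y \<in> pverts ?M" "c y = c (Orig w)" for y
          using that w x by (cases y) (auto simp: c)
        then show ?thesis using w(1) by (intro bexI[of _ "Orig w"]) auto
      qed
      \<comment> \<open>The apex dominates the class of all copies, which is nonempty because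
        \<open>G\<close> has a vertex.\<close>
      have ?thesis if "x = Apex"
      proof -
        obtain v where v: "v \<in> pverts G" using assms(2) by blast
        have "(x, y) \<in> parcs ?M" if "y \<in> pverts ?M" "c y = c (Copy v)" for y
          using that \<open>x = Apex\<close> by (cases y) (auto simp: c)
        then show ?thesis using v by (intro bexI[of _ "Copy v"]) auto
      qed
      then show ?thesis using lift that by (cases x) auto
    qed
  qed
  also have "\<dots> \<le> card (Orig ` P) + card {Copy {} :: 'a set mycielskian_vertex, Apex}"
    by (rule card_Un_le)
  also have "\<dots> \<le> card P + 2"
    using card_image_le[OF fin, of Orig] by simp
  finally show ?thesis using card_P by simp
qed

lemma less_total_dominator_chromatic_number_mycielskian:
  assumes "pair_graph G" and "pverts G \<noteq> {}" and "\<forall>v\<in>pverts G. \<exists>u. (v, u) \<in> parcs G"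
  shows "total_dominator_chromatic_number G
    < total_dominator_chromatic_number (mycielskian G)"
proof -
  interpret pair_graph G by fact
  let ?M = "mycielskian G"
  have sym: "(v, u) \<in> parcs G" if "(u, v) \<in> parcs G" for u v
    using arcs_symmetric that by auto
  have irrefl: "(v, v) \<notin> parcs G" for v
    using pair_no_loops by fastforce
  obtain Q where Q: "total_dominator_coloring ?M Q"
    and card_Q: "card Q = total_dominator_chromatic_number ?M" and fin: "finite Q"
    using total_dominator_chromatic_number_attained
      [OF pair_graph_mycielskian[OF assms(1)] mycielskian_no_isolated[OF assms]] .
  have part: "partition_on (pverts ?M) Q"
    and proper: "\<And>C x y. C \<in> Q \<Longrightarrow> x \<in> C \<Longrightarrow> y \<in> C \<Longrightarrow> (x, y) \<notin> parcs ?M"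
    and dominator: "\<And>x. x \<in> pverts ?M \<Longrightarrow> \<exists>C\<in>Q. \<forall>y\<in>C. (x, y) \<in> parcs ?M"
    using Q by (auto simp: total_dominator_coloring_def proper_coloring_def)
  have nonempty: "C \<noteq> {}" and sub: "C \<subseteq> pverts ?M" if "C \<in> Q" for C
    using that part by (auto simp: partition_on_def)
  obtain q where q: "\<And>x. x \<in> pverts ?M \<Longrightarrow> q x \<in> Q"
      "\<And>x C. C \<in> Q \<Longrightarrow> x \<in> C \<Longrightarrow> q x = C" "\<And>x. x \<in> pverts ?M \<Longrightarrow> x \<in> q x"
    by (rule partition_on_class_map[OF part]) blast
  have q_proper: "q x \<noteq> q y" if "(x, y) \<in> parcs ?M" "x \<in> pverts ?M" "y \<in> pverts ?M" for x y
    using that q proper by metis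
  have "\<exists>D\<in>Q. total_dominator_chromatic_number G \<le> card (Q - {D})"
  proof (cases "{Apex} \<in> Q")
    case False
    obtain D where D: "D \<in> Q" "\<forall>y\<in>D. (Apex, y) \<in> parcs ?M"
      using dominator[of Apex] by auto
    have "total_dominator_chromatic_number G \<le> card (Q - {D})"
    proof (rule total_dominator_chromatic_number_le_colors[where c = "\<lambda>v. q (Orig v)"])
      show "finite (Q - {D})" using fin by simp
      \<comment> \<open>All neighbours of the apex are copies, so no original vertex lies in
        \<open>D\<close>.\<close>
      show "q (Orig v) \<in> Q - {D}" if "v \<in> pverts G" for v
        using that q(1,3)[of "Orig v"] D by auto
      show "q (Orig u) \<noteq> q (Orig v)"
        if "(u, v) \<in> parcs G" "u \<in> pverts G" "v \<in> pverts G" for u v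
        using that q_proper by simp
      show "\<exists>w\<in>pverts G. \<forall>u\<in>pverts G. q (Orig u) = q (Orig w) \<longrightarrow> (v, u) \<in> parcs G"
        if v: "v \<in> pverts G" for v
      proof -
        \<comment> \<open>The copy is used instead of \<open>Orig v\<close> because it has no copies
          as neighbours: its dominated class lies among originals and the apex, and it is not
          \<open>{Apex}\<close> in this case.\<close>
        obtain C where C: "C \<in> Q" "\<forall>y\<in>C. (Copy v, y) \<in> parcs ?M"
          using dominator[of "Copy v"] v by auto
        have "\<exists>w. Orig w \<in> C"
        proof (rule ccontr)
          assume no_orig: "\<nexists>w. Orig w \<in> C"
          have "y = Apex" if "y \<in> C" for y
            using that C(2) no_orig by (cases y) auto
          then have "C = {Apex}" using nonempty[OF C(1)] by auto
          then show False using False C(1) by simp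
        qed
        then obtain w where w: "Orig w \<in> C" by blast
        have "(v, u) \<in> parcs G" if "u \<in> pverts G" "q (Orig u) = q (Orig w)" for u
          using that C q(3)[of "Orig u"] q(2)[OF C(1) w] by auto
        moreover have "w \<in> pverts G" using w sub[OF C(1)] by auto
        ultimately show ?thesis by blast
      qed
    qed
    then show ?thesis using D(1) by blast
  next
    case True
    define K where "K = {C \<in> Q. C \<subseteq> range Copy}"
    have "\<forall>C\<in>K. \<exists>v. Copy v \<in> C" using nonempty by (fastforce simp: K_def)
    then obtain r where r: "\<And>C. C \<in> K \<Longrightarrow> Copy (r C) \<in> C" by metis
    \<comment> \<open>Only representatives are recoloured. Each colour in \<open>K\<close> is then
      worn by exactly one vertex, while a vertex whose colour is outside \<open>K\<close> keeps its
      original class.\<close>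
    define c where "c v = q (if v \<in> r ` K then Copy v else Orig v)" for v
    have K_Q: "K \<subseteq> Q" by (auto simp: K_def)
    have q_rep: "q (Copy (r C)) = C" if "C \<in> K" for C
      using that r q(2) K_Q by blast
    have orig_notin_K: "q (Orig v) \<notin> K" if "v \<in> pverts G" for v
      using that q(3)[of "Orig v"] by (auto simp: K_def)
    have c_eq: "v = r C" if "v \<in> pverts G" "c v = C" "C \<in> K" for v C
      using that q_rep orig_notin_K by (auto simp: c_def split: if_splits)
    have c_rep: "c (r C) = C" if "C \<in> K" for C
      using that q_rep by (auto simp: c_def)
    have c_orig: "c v = q (Orig v)" if "v \<in> pverts G" "c v \<notin> K" for v
      using that c_rep by (auto simp: c_def)
    have "total_dominator_chromatic_number G \<le> card (Q - {{Apex}})"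
    proof (rule total_dominator_chromatic_number_le_colors[where c = c])
      show "finite (Q - {{Apex}})" using fin by simp
      show "c v \<in> Q - {{Apex}}" if "v \<in> pverts G" for v
        using that q(1,3)[of "Orig v"] q(1,3)[of "Copy v"] by (auto simp: c_def)
      show "c u \<noteq> c v" if uv: "(u, v) \<in> parcs G" "u \<in> pverts G" "v \<in> pverts G" for u v
      proof
        assume eq: "c u = c v"
        show False
        \<comment> \<open>A colour in \<open>K\<close> determines its vertex, so a clash would be a
          loop; any other clash already occurs between the originals in \<open>Q\<close>.\<close>
        proof (cases "c u \<in> K")
          case True
          then have "u = v" using c_eq[of u] c_eq[of v] uv eq by metis
          then show False using uv irrefl by simp
        next
          case False
          then have "q (Orig u) = q (Orig v)" using c_orig uv eq by metis
          then show False using q_proper uv by simp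
        qed
      qed
      show "\<exists>w\<in>pverts G. \<forall>u\<in>pverts G. c u = c w \<longrightarrow> (v, u) \<in> parcs G"
        if v: "v \<in> pverts G" for v
      proof -
        obtain C where C: "C \<in> Q" "\<forall>y\<in>C. (Orig v, y) \<in> parcs ?M"
          using dominator[of "Orig v"] v by auto
        \<comment> \<open>If \<open>C\<close> is in \<open>K\<close>, take its representative.
          Otherwise \<open>C\<close> contains some \<open>Orig w\<close>, since
          \<open>Orig v\<close> is not adjacent to the apex. This \<open>w\<close> may have been
          recoloured, whence the disjunction: its new class is then just \<open>w\<close>, and
          otherwise it consists of vertices whose originals lie in \<open>C\<close>. Either way
          \<open>v\<close> dominates it.\<close>
        have "\<exists>w\<in>pverts G. (v, w) \<in> parcs G \<and> (c w \<in> K \<or> c w = C)"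
        proof (cases "C \<in> K")
          case True
          have "(v, r C) \<in> parcs G" using C(2) r[OF True] sym by auto
          moreover have "r C \<in> pverts G" using sub[OF C(1)] r[OF True] by auto
          ultimately show ?thesis using c_rep[OF True] by auto
        next
          case False
          then obtain y where y: "y \<in> C" "y \<notin> range Copy" using C(1) by (auto simp: K_def)
          then obtain w where w: "y = Orig w" using C(2) by (cases y) auto
          have "w \<in> pverts G" "(v, w) \<in> parcs G" using y(1) w C sub[OF C(1)] by auto
          then show ?thesis using c_orig[of w] q(2)[OF C(1) y(1)] w by metis
        qed
        then obtain w where w: "w \<in> pverts G" "(v, w) \<in> parcs G" "c w \<in> K \<or> c w = C"
          by blast
        have "(v, u) \<in> parcs G" if u: "u \<in> pverts G" "c u = c w" for u
        proof (cases "c w \<in> K")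
          case True
          then have "u = w" using c_eq[of u] c_eq[of w] u w(1) by metis
          then show ?thesis using w(2) by simp
        next
          case False
          then have "q (Orig u) = C" using c_orig[of u] u w(3) by simp
          then show ?thesis using C(2) q(3)[of "Orig u"] u(1) by auto
        qed
        then show ?thesis using w(1) by blast
      qed
    qed
    then show ?thesis using True by blast
  qed
  then obtain D where "D \<in> Q" "total_dominator_chromatic_number G \<le> card (Q - {D})"
    by blast
  then show ?thesis using card_Diff1_less[OF fin] card_Q by fastforce
qed

theorem theorem2p1:
  fixes G :: "'a pair_pre_digraph"
  assumes "pair_graph G"
    and "pverts G \<noteq> {}"
    and "min_degree G \<ge> 1"
  shows "total_dominator_chromatic_number G + 1
           \<le> total_dominator_chromatic_number (mycielskian G)
       \<and> total_dominator_chromatic_number (mycielskian G)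
           \<le> total_dominator_chromatic_number G + 2"
proof -
  have no_isolated: "\<forall>v\<in>pverts G. \<exists>u. (v, u) \<in> parcs G"
    using assms min_degree_ge_1_iff by blast
  show ?thesis
    using less_total_dominator_chromatic_number_mycielskian[OF assms(1,2) no_isolated]
      total_dominator_chromatic_number_mycielskian_le[OF assms(1,2) no_isolated]
    by simp
qed

end
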